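(* Let $(a_0(n))_n$ and $(a_1(n))_n$ be real sequences with $2a_0(n)+a_1(n)=1$ for all $n$, and let $B_n^{M,1}$ be the associated modified Bernstein operators. Suppose $f\in C^2[0,1]$ and that the (finite) limit $L_1=\lim_{n\to\infty}a_1(n)$ exists. For $x\in[0,1]$ put $X:=x(1-x)$ and $X':=1-2x$. Then for every $x\in[0,1]$ and every integer $n\ge1$, \begin{align*} &\left|n\left[B_n^{M,1}(f;x)-f(x)\right]-\frac{x(1-x)}{2}f''(x)-\frac{1-2x}{2}(1+L_1)f'(x)\right|\\ &\le X\left\{\frac56\,\frac{|X'|}{\sqrt{3(n-2)X+1}}\;\omega_1\!\left(f'';\sqrt{\frac{3(n-2)X+1}{n^2}}\right)+\frac{13}{16}\,\omega_2\!\left(f'';\sqrt{\frac{3(n-2)X+1}{n^2}}\right)\right\}\\ &\quad+\frac{|X'|}{2}\left\{|L_1-a_1(n)|\,\|f'\|_\infty+|1+L_1|\left(\frac{13}{4}\,\omega_2\!\left(f';\frac1{\sqrt n}\right)+\frac1{\sqrt n}\,\omega_1\!\left(f';\frac1{\sqrt n}\right)\right)\right\}. \end{align*}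
   Context: Bernstein basis: $p_{n,k}(x)=\binom nk x^k(1-x)^{n-k}$ for $0\le k\le n$, $x\in[0,1]$ (with $0^0=1$), and $p_{n,k}=0$ if $k<0$ or $k>n$. Modified basis: given real sequences $a_0(n),a_1(n)$, put $a(x,n)=a_1(n)x+a_0(n)$ and, for $0\le k\le n$, $$p_{n,k}^{M,1}(x)=a(x,n)\,p_{n-1,k}(x)+a(1-x,n)\,p_{n-1,k-1}(x).$$ Modified Bernstein operator: $B_n^{M,1}(f;x)=\sum_{k=0}^n p_{n,k}^{M,1}(x)f(k/n)$. (No positivity is assumed.) Moduli, for $g\in C[0,1]$ and $\delta>0$: $\omega_1(g;\delta)=\sup\{|g(s)-g(t)|: s,t\in[0,1],\ |s-t|\le\delta\}$ and $\omega_2(g;\delta)=\sup\{|g(t-h)-2g(t)+g(t+h)|: 0\le h\le\delta,\ t\pm h\in[0,1]\}$. $\|\cdot\|_\infty$ is the sup norm on $[0,1]$. *)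

theory Defs
  imports "HOL-Analysis.Analysis"
begin

text \<open>
  The library's \<^const>\<open>Bernstein\<close> has a natural index and vanishes for indices above the degree;
  the index is extended to the integers because \<open>p_{n-1,k-1}\<close> is needed for \<open>k = 0\<close>.
\<close>

definition bernstein_basis :: "nat \<Rightarrow> int \<Rightarrow> real \<Rightarrow> real" where
  "bernstein_basis n k x = (if k < 0 then 0 else Bernstein n (nat k) x)"

definition mod_coeff :: "(nat \<Rightarrow> real) \<Rightarrow> (nat \<Rightarrow> real) \<Rightarrow> real \<Rightarrow> nat \<Rightarrow> real" where
  "mod_coeff a0 a1 x n = a1 n * x + a0 n"

text \<open>The next two definitions are meaningful for \<open>n \<ge> 1\<close> only (\<open>n - 1\<close> is truncated).\<close>

definition mod_bernstein_basis ::
    "(nat \<Rightarrow> real) \<Rightarrow> (nat \<Rightarrow> real) \<Rightarrow> nat \<Rightarrow> nat \<Rightarrow> real \<Rightarrow> real" where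
  "mod_bernstein_basis a0 a1 n k x =
     mod_coeff a0 a1 x n * bernstein_basis (n - 1) (int k) x
     + mod_coeff a0 a1 (1 - x) n * bernstein_basis (n - 1) (int k - 1) x"

definition mod_bernstein_op ::
    "(nat \<Rightarrow> real) \<Rightarrow> (nat \<Rightarrow> real) \<Rightarrow> nat \<Rightarrow> (real \<Rightarrow> real) \<Rightarrow> real \<Rightarrow> real" where
  "mod_bernstein_op a0 a1 n f x =
     (\<Sum>k = 0..n. mod_bernstein_basis a0 a1 n k x * f (real k / real n))"

text \<open>
  The suprema below are taken in the reals, so they are meaningful for functions that are
  bounded on \<open>[0,1]\<close>, in particular for continuous ones. Only values on \<open>[0,1]\<close> enter.
\<close>

definition modulus1 :: "(real \<Rightarrow> real) \<Rightarrow> real \<Rightarrow> real" where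
  "modulus1 g \<delta> = Sup {\<bar>g s - g t\<bar> | s t. s \<in> {0..1} \<and> t \<in> {0..1} \<and> \<bar>s - t\<bar> \<le> \<delta>}"

definition modulus2 :: "(real \<Rightarrow> real) \<Rightarrow> real \<Rightarrow> real" where
  "modulus2 g \<delta> =
     Sup {\<bar>g (t - h) - 2 * g t + g (t + h)\<bar> | t h.
            0 \<le> h \<and> h \<le> \<delta> \<and> t - h \<in> {0..1} \<and> t + h \<in> {0..1}}"

definition sup_norm :: "(real \<Rightarrow> real) \<Rightarrow> real" where
  "sup_norm g = (SUP t\<in>{0..1}. \<bar>g t\<bar>)"

end

theory Submission
  imports Defs
begin

text \<open>
  With \<open>B_n\<close> the classical Bernstein operator, \<open>2 a_0 + a_1 = 1\<close> gives
  \<open>n (B_n^M f - B_n f) = (1 + a_1) X'/2 (B_n f)'\<close>, so it suffices to estimate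
  \<open>n (B_n f - f) - (X/2) f''\<close> and \<open>(B_n f)' - f'\<close>. These are the deviations from point
  evaluation of positive functionals of \<open>f''\<close> and \<open>f'\<close>, up to the factor \<open>X/2\<close>.

  Such a functional is controlled by a pointwise majorant
  \<open>g t \<le> g x + l (t - x) + (1 + (t - x)^2 / (2 h^2)) w\<close>, where \<open>w\<close> bounds the second
  differences of \<open>g\<close> with step at most \<open>h\<close>. A slope \<open>l\<close> exists because \<open>g\<close> deviates from
  its chord over \<open>[y,z]\<close> by at most \<open>(1 + (z - t) (t - y) / (2 h^2)) w\<close>.
  On a majorant both functionals are given by central moments. Positivity
  is used as Jensen's inequality for \<open>B_n\<close> and as monotonicity of \<open>(B_n f)'\<close> in \<open>f'\<close>. The constants
  leave room to take \<open>h\<close> to be half the argument of the moduli, which keeps \<open>h \<le> 1/2\<close>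
  for every \<open>n \<ge> 1\<close>.
\<close>

section \<open>Second differences and quadratic majorants\<close>

text \<open>Any bound \<open>w\<close> is allowed, not only the supremum. The property survives
  negation and reflection: the first turns upper estimates into lower ones, the second reduces
  \<open>x > 1 / 2\<close> to \<open>x \<le> 1 / 2\<close>.\<close>

definition second_diff_le :: "(real \<Rightarrow> real) \<Rightarrow> real \<Rightarrow> real \<Rightarrow> bool" where
  "second_diff_le g h w \<longleftrightarrow>
     (\<forall>t d. 0 \<le> d \<longrightarrow> d \<le> h \<longrightarrow> t - d \<in> {0..1} \<longrightarrow> t + d \<in> {0..1} \<longrightarrow>
        \<bar>g (t - d) - 2 * g t + g (t + d)\<bar> \<le> w)"

lemma second_diff_leD:
  assumes "second_diff_le g h w" "0 \<le> d" "d \<le> h" "0 \<le> t - d" "t + d \<le> 1"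
  shows "\<bar>g (t - d) - 2 * g t + g (t + d)\<bar> \<le> w"
proof -
  have "t - d \<in> {0..1}" "t + d \<in> {0..1}"
    using assms by auto
  then show ?thesis
    using assms unfolding second_diff_le_def by blast
qed

lemma second_diff_le_nonneg:
  assumes "second_diff_le g h w" "0 \<le> h"
  shows "0 \<le> w"
  using second_diff_leD[OF assms(1), of 0 0] assms(2) by simp

lemma second_diff_le_uminus:
  assumes "second_diff_le g h w"
  shows "second_diff_le (\<lambda>t. - g t) h w"
  unfolding second_diff_le_def
proof (intro allI impI)
  fix t d :: real
  assume "0 \<le> d" "d \<le> h" "t - d \<in> {0..1}" "t + d \<in> {0..1}"
  then have "\<bar>g (t - d) - 2 * g t + g (t + d)\<bar> \<le> w"
    using assms unfolding second_diff_le_def by blast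
  then show "\<bar>- g (t - d) - 2 * - g t + - g (t + d)\<bar> \<le> w"
    by linarith
qed

lemma second_diff_le_reflect:
  assumes "second_diff_le g h w"
  shows "second_diff_le (\<lambda>t. g (1 - t)) h w"
  unfolding second_diff_le_def
proof (intro allI impI)
  fix t d :: real
  assume *: "0 \<le> d" "d \<le> h" "t - d \<in> {0..1}" "t + d \<in> {0..1}"
  have "\<bar>g (1 - t - d) - 2 * g (1 - t) + g (1 - t + d)\<bar> \<le> w"
    by (rule second_diff_leD[OF assms]) (use * in auto)
  then show "\<bar>g (1 - (t - d)) - 2 * g (1 - t) + g (1 - (t + d))\<bar> \<le> w"
    by (simp add: algebra_simps)
qed

text \<open>
  Subtracting \<open>w\<close> times the quadratic leaves a function \<open>D\<close> that is midpoint convex at scale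
  exactly \<open>h\<close>, so its leftmost maximizer is closer than \<open>h\<close> to an end of the interval;
  reflecting that end in the maximizer bounds the maximum by \<open>w\<close>.
\<close>
lemma above_chord_le:
  fixes v :: "real \<Rightarrow> real"
  assumes cont: "continuous_on {y..z} v" and h: "0 < h" and t: "t \<in> {y..z}"
    and d2: "\<And>s d. 0 \<le> d \<Longrightarrow> d \<le> h \<Longrightarrow> y \<le> s - d \<Longrightarrow> s + d \<le> z \<Longrightarrow>
               - w \<le> v (s - d) - 2 * v s + v (s + d)"
    and ends: "v y = 0" "v z = 0"
  shows "v t \<le> (1 + (z - t) * (t - y) / (2 * h\<^sup>2)) * w"
proof -
  define D where "D = (\<lambda>s. v s - w * ((z - s) * (s - y) / (2 * h\<^sup>2)))"
  have "- w \<le> v (y - 0) - 2 * v y + v (y + 0)"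
    by (rule d2) (use h t in auto)
  then have w: "0 \<le> w"
    using ends by simp
  have contD: "continuous_on {y..z} D"
    unfolding D_def by (intro continuous_intros cont) (use h in auto)
  \<comment> \<open>The second difference of \<open>(z - s) * (s - y)\<close> is
    \<open>- 2 * d\<^sup>2\<close>, so the added term is exactly \<open>w\<close> at
    \<open>d = h\<close>.\<close>
  have D2: "D (s - d) - 2 * D s + D (s + d)
      = v (s - d) - 2 * v s + v (s + d) + w * (d\<^sup>2 / h\<^sup>2)" for s d
    using h unfolding D_def by (simp add: divide_simps) algebra
  obtain t1 where t1: "t1 \<in> {y..z}" and max1: "\<And>s. s \<in> {y..z} \<Longrightarrow> D s \<le> D t1"
    using continuous_attains_sup[OF _ _ contD] t by auto
  define T where "T = {y..z} \<inter> D -` {D t1}"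
  have "closed T"
    unfolding T_def by (intro continuous_closed_preimage contD) auto
  then have "compact T"
    unfolding compact_eq_bounded_closed T_def
    by (metis bounded_Int bounded_closed_interval)
  moreover have "T \<noteq> {}"
    using t1 unfolding T_def by auto
  ultimately obtain t0 where t0: "t0 \<in> T" and least: "\<And>s. s \<in> T \<Longrightarrow> t0 \<le> s"
    using compact_attains_inf by metis
  have t0I: "t0 \<in> {y..z}" and t0M: "D t0 = D t1"
    using t0 unfolding T_def by auto
  \<comment> \<open>At a maximizer, midpoint convexity with step \<open>h\<close> makes both
    neighbours maximizers, and \<open>t0 - h\<close> would be one to the left of
    \<open>t0\<close>.\<close>
  have "\<not> (y \<le> t0 - h \<and> t0 + h \<le> z)"
  proof
    assume *: "y \<le> t0 - h \<and> t0 + h \<le> z"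
    have "- w \<le> v (t0 - h) - 2 * v t0 + v (t0 + h)"
      by (rule d2) (use * h in auto)
    then have "0 \<le> D (t0 - h) - 2 * D t0 + D (t0 + h)"
      using h unfolding D2 by simp
    moreover have "D (t0 + h) \<le> D t1" "D (t0 - h) \<le> D t1"
      by (rule max1, use * h in auto)+
    ultimately have "t0 - h \<in> T"
      using t0M * h unfolding T_def by auto
    then show False
      using least h by fastforce
  qed
  \<comment> \<open>One of \<open>t0 - d\<close> and \<open>t0 + d\<close> is an endpoint, where
    \<open>D\<close> vanishes; at the other \<open>D\<close> is at most \<open>D t1\<close>. The
    second difference of \<open>D\<close> at \<open>t0\<close> is therefore at most
    \<open>- D t1\<close>, yet at least \<open>- w\<close>.\<close>
  moreover define d where "d = min (t0 - y) (z - t0)"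
  ultimately have d: "0 \<le> d" "d \<le> h" "y \<le> t0 - d" "t0 + d \<le> z" "t0 - d = y \<or> t0 + d = z"
    using t0I by (auto simp: min_def)
  have "D y = 0" "D z = 0"
    using ends unfolding D_def by auto
  then have "D (t0 - d) + D (t0 + d) \<le> D t1"
    using d max1[of "t0 - d"] max1[of "t0 + d"] t0I by auto
  moreover have "- w \<le> v (t0 - d) - 2 * v t0 + v (t0 + d)"
    by (rule d2) (use d in auto)
  moreover have "0 \<le> w * (d\<^sup>2 / h\<^sup>2)"
    using w by simp
  ultimately have "D t1 \<le> w"
    using D2[of t0 d] t0M by linarith
  then have "D t \<le> w"
    using max1[OF t] by simp
  then show ?thesis
    unfolding D_def by (simp add: algebra_simps)
qed

text \<open>Subtracting the chord keeps second differences and makes the ends vanish, so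
  \<open>above_chord_le\<close> applies to \<open>g\<close> and to \<open>- g\<close>. Both sides
  carry the factor \<open>z - y\<close>, which spares later comparisons a division.\<close>

lemma chord_deviation_le:
  fixes g :: "real \<Rightarrow> real"
  assumes cont: "continuous_on {0..1} g" and h: "0 < h" and d2: "second_diff_le g h w"
    and "0 \<le> y" "y \<le> t" "t \<le> z" "z \<le> 1" "y < z"
  shows "\<bar>(z - t) * g y + (t - y) * g z - (z - y) * g t\<bar>
           \<le> (z - y) * ((1 + (z - t) * (t - y) / (2 * h\<^sup>2)) * w)"
proof -
  have one_sided: "(z - y) * g t - ((z - t) * g y + (t - y) * g z)
      \<le> (z - y) * ((1 + (z - t) * (t - y) / (2 * h\<^sup>2)) * w)"
    if cont: "continuous_on {0..1} g" and d2: "second_diff_le g h w" for g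
  proof -
    define m where "m = (g z - g y) / (z - y)"
    define v where "v = (\<lambda>s. g s - (g y + m * (s - y)))"
    have m: "(z - y) * m = g z - g y"
      using \<open>y < z\<close> unfolding m_def by simp
    have "v t \<le> (1 + (z - t) * (t - y) / (2 * h\<^sup>2)) * w"
    proof (rule above_chord_le)
      show "continuous_on {y..z} v"
        unfolding v_def using assms
        by (intro continuous_intros continuous_on_subset[OF cont]) auto
      show "- w \<le> v (s - d) - 2 * v s + v (s + d)"
        if "0 \<le> d" "d \<le> h" "y \<le> s - d" "s + d \<le> z" for s d
      proof -
        have "\<bar>g (s - d) - 2 * g s + g (s + d)\<bar> \<le> w"
          by (rule second_diff_leD[OF d2]) (use that assms in auto)
        moreover have "v (s - d) - 2 * v s + v (s + d) = g (s - d) - 2 * g s + g (s + d)"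
          unfolding v_def by (simp add: algebra_simps)
        ultimately show ?thesis by linarith
      qed
      show "v y = 0" "v z = 0"
        using m unfolding v_def by (simp_all add: algebra_simps)
    qed (use assms in auto)
    then have "(z - y) * v t \<le> (z - y) * ((1 + (z - t) * (t - y) / (2 * h\<^sup>2)) * w)"
      using \<open>y < z\<close> by (intro mult_left_mono) auto
    moreover have "(z - y) * v t = (z - y) * g t - ((z - t) * g y + (t - y) * g z)"
    proof -
      have "(z - y) * v t = (z - y) * g t - (z - y) * g y - ((z - y) * m) * (t - y)"
        unfolding v_def by (simp add: algebra_simps)
      then show ?thesis
        unfolding m by (simp add: algebra_simps)
    qed
    ultimately show ?thesis by simp
  qed
  have "(z - y) * - g t - ((z - t) * - g y + (t - y) * - g z)
      \<le> (z - y) * ((1 + (z - t) * (t - y) / (2 * h\<^sup>2)) * w)"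
    by (rule one_sided) (intro continuous_on_minus cont second_diff_le_uminus d2)+
  then show ?thesis
    using one_sided[OF cont d2] by (simp add: abs_le_iff algebra_simps)
qed

text \<open>Points to the right of \<open>x\<close> bound the admissible \<open>l\<close> from
  below, points to the left from above. The supremum of the lower constraints works: the chord
  inequality with \<open>x\<close> as inner point makes the two kinds compatible, and comparison
  with \<open>x + h\<close> bounds the supremum.\<close>

lemma quadratic_majorant_right:
  fixes g :: "real \<Rightarrow> real"
  assumes cont: "continuous_on {0..1} g" and h: "0 < h" and d2: "second_diff_le g h w"
    and x: "0 \<le> x" "x + h \<le> 1" and W: "\<bar>g (x + h) - g x\<bar> \<le> W"
  shows "\<exists>l. l \<le> (W + w / 2) / h \<and>
    (\<forall>t\<in>{0..1}. g t \<le> g x + l * (t - x) + (1 + (t - x)\<^sup>2 / (2 * h\<^sup>2)) * w)"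
proof -
  define slope where "slope = (\<lambda>t. (g t - g x - (1 + (t - x)\<^sup>2 / (2 * h\<^sup>2)) * w) / (t - x))"
  define l where "l = (SUP t\<in>{x<..1}. slope t)"
  have w: "0 \<le> w"
    using second_diff_le_nonneg d2 h by simp
  have ne: "{x<..1} \<noteq> {}"
    using x h by auto
  have le: "slope t \<le> (W + w / 2) / h" if t: "t \<in> {x<..1}" for t
  proof -
    define s where "s = t - x"
    have s: "0 < s" "t = x + s"
      using t unfolding s_def by auto
    have "h * (g t - g x - (1 + s\<^sup>2 / (2 * h\<^sup>2)) * w) \<le> s * (W + w / 2)"
    \<comment> \<open>For \<open>s \<le> h\<close> the chord over \<open>{x..x + h}\<close> is
      compared with \<open>g\<close> at \<open>t\<close>; otherwise the chord over
      \<open>{x..t}\<close> is compared with \<open>g\<close> at \<open>x + h\<close>.\<close>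
    proof (cases "s \<le> h")
      case True
      have "\<bar>(x + h - t) * g x + (t - x) * g (x + h) - (x + h - x) * g t\<bar>
           \<le> (x + h - x) * ((1 + (x + h - t) * (t - x) / (2 * h\<^sup>2)) * w)"
        by (rule chord_deviation_le[OF cont h d2]) (use s True x h in auto)
      then have "h * (g t - g x) - s * (g (x + h) - g x) \<le> h * ((1 + (h - s) * s / (2 * h\<^sup>2)) * w)"
        unfolding s(2) by (simp add: algebra_simps abs_le_iff)
      moreover have "h * ((1 + (h - s) * s / (2 * h\<^sup>2)) * w) =
          h * ((1 + s\<^sup>2 / (2 * h\<^sup>2)) * w) + s * w / 2 - w * s\<^sup>2 / h"
        using h by (simp add: divide_simps) algebra
      moreover have "s * (g (x + h) - g x) \<le> s * W"
        using W s by (intro mult_left_mono) auto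
      moreover have "0 \<le> w * s\<^sup>2 / h"
        using w h by simp
      ultimately show ?thesis
        by (simp add: algebra_simps)
    next
      case False
      have "\<bar>(t - (x + h)) * g x + (x + h - x) * g t - (t - x) * g (x + h)\<bar>
           \<le> (t - x) * ((1 + (t - (x + h)) * (x + h - x) / (2 * h\<^sup>2)) * w)"
        by (rule chord_deviation_le[OF cont h d2]) (use s False x h t in auto)
      then have "h * (g t - g x) - s * (g (x + h) - g x) \<le> s * ((1 + (s - h) * h / (2 * h\<^sup>2)) * w)"
        unfolding s(2) by (simp add: algebra_simps abs_le_iff)
      moreover have "s * ((1 + (s - h) * h / (2 * h\<^sup>2)) * w) =
          h * ((1 + s\<^sup>2 / (2 * h\<^sup>2)) * w) + s * w / 2 - h * w"
        using h by (simp add: divide_simps) algebra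
      moreover have "s * (g (x + h) - g x) \<le> s * W"
        using W s by (intro mult_left_mono) auto
      moreover have "0 \<le> h * w"
        using w h by simp
      ultimately show ?thesis
        by (simp add: algebra_simps)
    qed
    then show ?thesis
      unfolding slope_def s_def[symmetric] using s(1) h
      by (simp add: pos_divide_le_eq pos_le_divide_eq mult.commute)
  qed
  then have bdd: "bdd_above (slope ` {x<..1})"
    by (rule bdd_aboveI2)
  have "l \<le> (W + w / 2) / h"
    unfolding l_def using ne le by (intro cSUP_least) auto
  moreover have "g t \<le> g x + l * (t - x) + (1 + (t - x)\<^sup>2 / (2 * h\<^sup>2)) * w" if t: "t \<in> {0..1}" for t
  proof -
    consider "t < x" | "t = x" | "x < t" by linarith
    then show ?thesis
    proof cases
      case 1
      \<comment> \<open>The largest slope that the point \<open>t\<close> to the left of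
        \<open>x\<close> admits.\<close>
      define b where "b = (g x + (1 + (t - x)\<^sup>2 / (2 * h\<^sup>2)) * w - g t) / (x - t)"
      have "slope z \<le> b" if z: "z \<in> {x<..1}" for z
      proof -
        define p q where "p = x - t" and "q = z - x"
        have pq: "0 < p" "0 < q" "t = x - p" "z = x + q"
          using 1 z unfolding p_def q_def by auto
        have "\<bar>(z - x) * g t + (x - t) * g z - (z - t) * g x\<bar>
           \<le> (z - t) * ((1 + (z - x) * (x - t) / (2 * h\<^sup>2)) * w)"
          by (rule chord_deviation_le[OF cont h d2]) (use t z 1 in auto)
        then have "q * g t + p * g z - (p + q) * g x \<le> (p + q) * ((1 + q * p / (2 * h\<^sup>2)) * w)"
          unfolding pq by (simp add: algebra_simps abs_le_iff)
        \<comment> \<open>The chord error splits exactly into the majorant errors at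
          \<open>z\<close> and \<open>t\<close> with weights \<open>p\<close> and \<open>q\<close>;
          this is why the majorant has the form
          \<open>1 + (t - x)\<^sup>2 / (2 * h\<^sup>2)\<close>.\<close>
        also have "\<dots> = p * ((1 + q\<^sup>2 / (2 * h\<^sup>2)) * w) + q * ((1 + p\<^sup>2 / (2 * h\<^sup>2)) * w)"
          using h by (simp add: divide_simps) algebra
        finally have "p * (g z - g x - (1 + q\<^sup>2 / (2 * h\<^sup>2)) * w)
            \<le> q * (g x + (1 + p\<^sup>2 / (2 * h\<^sup>2)) * w - g t)"
          by (simp add: algebra_simps)
        moreover have "(t - x)\<^sup>2 = p\<^sup>2"
          unfolding p_def by (rule power2_commute)
        ultimately show ?thesis
          unfolding slope_def b_def p_def[symmetric] q_def[symmetric]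
          using pq(1,2) by (simp add: divide_simps mult.commute)
      qed
      then have "l \<le> b"
        unfolding l_def using ne by (intro cSUP_least) auto
      then have "l * (x - t) \<le> g x + (1 + (t - x)\<^sup>2 / (2 * h\<^sup>2)) * w - g t"
        unfolding b_def using 1 by (simp add: pos_le_divide_eq)
      then show ?thesis
        by (simp add: algebra_simps)
    next
      case 2
      then show ?thesis using w by simp
    next
      case 3
      then have "slope t \<le> l"
        unfolding l_def using t by (intro cSUP_upper bdd) auto
      then have "g t - g x - (1 + (t - x)\<^sup>2 / (2 * h\<^sup>2)) * w \<le> l * (t - x)"
        unfolding slope_def using 3 by (simp add: pos_divide_le_eq)
      then show ?thesis by simp
    qed
  qed
  ultimately show ?thesis by blast
qed

text \<open>If \<open>x \<le> 1 / 2\<close>, then \<open>h \<le> 1 / 2\<close> leaves room for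
  \<open>x + h\<close>; otherwise reflection applies and changes the sign of \<open>l\<close>. Only
  \<open>l * (1 - 2 * x)\<close> is bounded, since the slope enters both functionals through this
  product.\<close>

lemma quadratic_majorant:
  fixes g :: "real \<Rightarrow> real"
  assumes cont: "continuous_on {0..1} g" and h: "0 < h" "h \<le> 1 / 2"
    and d2: "second_diff_le g h w" and x: "x \<in> {0..1}"
    and W: "\<And>s t. s \<in> {0..1} \<Longrightarrow> t \<in> {0..1} \<Longrightarrow> \<bar>s - t\<bar> \<le> h \<Longrightarrow> \<bar>g s - g t\<bar> \<le> W"
  obtains l where "l * (1 - 2 * x) \<le> \<bar>1 - 2 * x\<bar> * ((W + w / 2) / h)"
    and "\<And>t. t \<in> {0..1} \<Longrightarrow> g t \<le> g x + l * (t - x) + (1 + (t - x)\<^sup>2 / (2 * h\<^sup>2)) * w"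
proof (cases "x \<le> 1 / 2")
  case True
  have "\<exists>l. l \<le> (W + w / 2) / h \<and>
    (\<forall>t\<in>{0..1}. g t \<le> g x + l * (t - x) + (1 + (t - x)\<^sup>2 / (2 * h\<^sup>2)) * w)"
    by (rule quadratic_majorant_right[OF cont h(1) d2]) (use True x h in \<open>auto intro!: W\<close>)
  then obtain l where l: "l \<le> (W + w / 2) / h"
    "\<And>t. t \<in> {0..1} \<Longrightarrow> g t \<le> g x + l * (t - x) + (1 + (t - x)\<^sup>2 / (2 * h\<^sup>2)) * w"
    by blast
  have "(1 - 2 * x) * l \<le> (1 - 2 * x) * ((W + w / 2) / h)"
    using l(1) True by (intro mult_left_mono) auto
  with l(2) show ?thesis
    using that[of l] True by (simp add: mult.commute)
next
  case False
  have cont': "continuous_on {0..1} (\<lambda>t. g (1 - t))"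
    by (rule continuous_on_compose2[OF cont]) (auto intro!: continuous_intros)
  have "\<exists>l. l \<le> (W + w / 2) / h \<and>
    (\<forall>t\<in>{0..1}. g (1 - t) \<le> g (1 - (1 - x)) + l * (t - (1 - x)) + (1 + (t - (1 - x))\<^sup>2 / (2 * h\<^sup>2)) * w)"
    by (rule quadratic_majorant_right[OF cont' h(1) second_diff_le_reflect[OF d2]])
      (use False x h in \<open>auto intro!: W\<close>)
  then obtain l where l: "l \<le> (W + w / 2) / h"
    "\<And>t. t \<in> {0..1} \<Longrightarrow> g (1 - t) \<le> g x + l * (t - (1 - x)) + (1 + (t - (1 - x))\<^sup>2 / (2 * h\<^sup>2)) * w"
    by auto
  have "(2 * x - 1) * l \<le> (2 * x - 1) * ((W + w / 2) / h)"
    using l(1) False by (intro mult_left_mono) auto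
  moreover have "g t \<le> g x + - l * (t - x) + (1 + (t - x)\<^sup>2 / (2 * h\<^sup>2)) * w" if "t \<in> {0..1}" for t
  proof -
    have "(1 - t - (1 - x))\<^sup>2 = (t - x)\<^sup>2"
      by (simp add: power2_commute)
    then show ?thesis
      using l(2)[of "1 - t"] that by (simp add: algebra_simps)
  qed
  ultimately show ?thesis
    using that[of "- l"] False by (simp add: algebra_simps)
qed

section \<open>Bernstein basis: degree raising and central moments\<close>

lemma bernstein_basis_of_nat [simp]: "bernstein_basis n (int k) x = Bernstein n k x"
  by (simp add: bernstein_basis_def)

lemma Bernstein_eq_0: "n < k \<Longrightarrow> Bernstein n k x = 0"
  by (simp add: Bernstein_def)

text \<open>The first basis term vanishes at \<open>k = Suc m\<close> and the second at
  \<open>k = 0\<close>, so both become sums over \<open>k \<le> m\<close>. Both the classical basis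
  of degree \<open>Suc m\<close> and the modified one have this shape.\<close>

lemma sum_bernstein_basis_split:
  "(\<Sum>k = 0..Suc m. (c * bernstein_basis m (int k) x + d * bernstein_basis m (int k - 1) x) * u k)
     = (\<Sum>k\<le>m. Bernstein m k x * (c * u k + d * u (Suc k)))"
proof -
  have "(\<Sum>k = 0..Suc m. bernstein_basis m (int k) x * u k) = (\<Sum>k\<le>m. Bernstein m k x * u k)"
    by (simp add: Bernstein_eq_0 atLeast0AtMost)
  moreover have "(\<Sum>k = 0..Suc m. bernstein_basis m (int k - 1) x * u k)
      = (\<Sum>k\<le>m. Bernstein m k x * u (Suc k))"
    by (subst sum.atLeast0_atMost_Suc_shift) (simp add: bernstein_basis_def atLeast0AtMost)
  moreover have "(\<Sum>k = 0..Suc m. (c * bernstein_basis m (int k) x + d * bernstein_basis m (int k - 1) x) * u k)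
     = c * (\<Sum>k = 0..Suc m. bernstein_basis m (int k) x * u k)
       + d * (\<Sum>k = 0..Suc m. bernstein_basis m (int k - 1) x * u k)"
    unfolding sum_distrib_left sum.distrib[symmetric]
    by (rule sum.cong) (simp_all add: algebra_simps)
  ultimately show ?thesis
    by (simp add: sum_distrib_left sum.distrib algebra_simps)
qed

text \<open>Pascal's rule, in the form of the modified basis with coefficients \<open>1 - x\<close>
  and \<open>x\<close>.\<close>

lemma Bernstein_Suc:
  "Bernstein (Suc m) k x
     = (1 - x) * bernstein_basis m (int k) x + x * bernstein_basis m (int k - 1) x"
proof (cases k)
  case 0
  then show ?thesis by (simp add: bernstein_basis_def Bernstein_def)
next
  case (Suc j)
  then have [simp]: "bernstein_basis m (int k - 1) x = Bernstein m j x"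
    by (simp add: bernstein_basis_def)
  show ?thesis
  proof (cases "j < m")
    case True
    then have "m - j = Suc (m - Suc j)" by simp
    then show ?thesis
      using Suc by (simp add: Bernstein_def bernstein_basis_def nat_add_distrib algebra_simps)
  next
    case False
    then show ?thesis
      using Suc by (cases "j = m") (simp_all add: Bernstein_def bernstein_basis_def nat_add_distrib binomial_eq_0)
  qed
qed

lemma sum_Bernstein_Suc:
  "(\<Sum>k\<le>Suc m. Bernstein (Suc m) k x * u k)
     = (\<Sum>k\<le>m. Bernstein m k x * ((1 - x) * u k + x * u (Suc k)))"
  unfolding Bernstein_Suc atLeast0AtMost[symmetric]
  using sum_bernstein_basis_split[of "1 - x" m x x u] by (simp add: atLeast0AtMost)

text \<open>Induction by adding one Bernoulli trial: the centred variable moves by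
  \<open>- x\<close> with weight \<open>1 - x\<close> and by \<open>1 - x\<close> with weight
  \<open>x\<close>, so each new moment is a linear combination of old ones.\<close>

lemma Bernstein_central_moments:
  fixes x :: real
  defines "X \<equiv> x * (1 - x)"
  shows "(\<Sum>k\<le>n. Bernstein n k x * (real k - real n * x)) = 0" (is ?m1)
    and "(\<Sum>k\<le>n. Bernstein n k x * (real k - real n * x)\<^sup>2) = real n * X" (is ?m2)
    and "(\<Sum>k\<le>n. Bernstein n k x * (real k - real n * x) ^ 3) = real n * X * (1 - 2 * x)" (is ?m3)
    and "(\<Sum>k\<le>n. Bernstein n k x * (real k - real n * x) ^ 4)
           = real n * X * (3 * (real n - 2) * X + 1)" (is ?m4)
proof -
  have "?m1 \<and> ?m2 \<and> ?m3 \<and> ?m4"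
  proof (induction n)
    case 0
    show ?case by (simp add: Bernstein_def)
  next
    case (Suc n)
    define E where "E = (\<lambda>u :: nat \<Rightarrow> real. \<Sum>k\<le>n. Bernstein n k x * u k)"
    define c where "c = (\<lambda>k. real k - real n * x)"
    have E: "E (\<lambda>k. u k + v k) = E u + E v" "E (\<lambda>k. r * u k) = r * E u" for u v r
      unfolding E_def by (simp_all add: sum.distrib sum_distrib_left algebra_simps)
    \<comment> \<open>All five coefficients are kept, even when zero, so that a single rewrite rule
      evaluates each of the four moments below.\<close>
    have poly: "E (\<lambda>k. r0 * 1 + (r1 * c k + (r2 * (c k)\<^sup>2 + (r3 * c k ^ 3 + r4 * c k ^ 4))))
        = r0 + r2 * (real n * X) + r3 * (real n * X * (1 - 2 * x))
          + r4 * (real n * X * (3 * (real n - 2) * X + 1))" for r0 r1 r2 r3 r4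
    proof -
      have "E (\<lambda>k. 1) = 1"
        by (simp add: E_def sum_Bernstein)
      moreover have "E c = 0" "E (\<lambda>k. (c k)\<^sup>2) = real n * X"
        "E (\<lambda>k. c k ^ 3) = real n * X * (1 - 2 * x)"
        "E (\<lambda>k. c k ^ 4) = real n * X * (3 * (real n - 2) * X + 1)"
        using Suc unfolding E_def c_def by auto
      ultimately show ?thesis
        unfolding E by simp
    qed
    have step: "(\<Sum>k\<le>Suc n. Bernstein (Suc n) k x * (real k - real (Suc n) * x) ^ j)
        = E (\<lambda>k. (1 - x) * (c k - x) ^ j + x * (c k + (1 - x)) ^ j)" for j
      unfolding sum_Bernstein_Suc E_def c_def by (simp add: algebra_simps)
    have 1: "(\<lambda>k. (1 - x) * (c k - x) ^ 1 + x * (c k + (1 - x)) ^ 1) =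
       (\<lambda>k. 0 * 1 + (1 * c k + (0 * (c k)\<^sup>2 + (0 * c k ^ 3 + 0 * c k ^ 4))))"
      by (rule ext) (simp add: algebra_simps)
    have 2: "(\<lambda>k. (1 - x) * (c k - x) ^ 2 + x * (c k + (1 - x)) ^ 2) =
       (\<lambda>k. X * 1 + (0 * c k + (1 * (c k)\<^sup>2 + (0 * c k ^ 3 + 0 * c k ^ 4))))"
      unfolding X_def by (rule ext) algebra
    have 3: "(\<lambda>k. (1 - x) * (c k - x) ^ 3 + x * (c k + (1 - x)) ^ 3) =
       (\<lambda>k. (X * (1 - 2 * x)) * 1 + ((3 * X) * c k + (0 * (c k)\<^sup>2 + (1 * c k ^ 3 + 0 * c k ^ 4))))"
      unfolding X_def by (rule ext) algebra
    have 4: "(\<lambda>k. (1 - x) * (c k - x) ^ 4 + x * (c k + (1 - x)) ^ 4) =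
       (\<lambda>k. (X * (1 - 3 * X)) * 1 + ((4 * X * (1 - 2 * x)) * c k
          + ((6 * X) * (c k)\<^sup>2 + (0 * c k ^ 3 + 1 * c k ^ 4))))"
      unfolding X_def by (rule ext) algebra
    note s1 = step[of 1, unfolded 1 poly] and s2 = step[of 2, unfolded 2 poly]
      and s3 = step[of 3, unfolded 3 poly] and s4 = step[of 4, unfolded 4 poly]
    show ?case
    proof (intro conjI)
      show "(\<Sum>k\<le>Suc n. Bernstein (Suc n) k x * (real k - real (Suc n) * x)) = 0"
        using s1 by simp
      show "(\<Sum>k\<le>Suc n. Bernstein (Suc n) k x * (real k - real (Suc n) * x)\<^sup>2) = real (Suc n) * X"
        unfolding s2 by (simp add: algebra_simps)
      show "(\<Sum>k\<le>Suc n. Bernstein (Suc n) k x * (real k - real (Suc n) * x) ^ 3)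
          = real (Suc n) * X * (1 - 2 * x)"
        unfolding s3 by (simp add: algebra_simps)
      show "(\<Sum>k\<le>Suc n. Bernstein (Suc n) k x * (real k - real (Suc n) * x) ^ 4)
          = real (Suc n) * X * (3 * (real (Suc n) - 2) * X + 1)"
        unfolding s4 by (simp add: algebra_simps power2_eq_square)
    qed
  qed
  then show ?m1 ?m2 ?m3 ?m4 by auto
qed

section \<open>Positivity: Jensen's inequality and integrated majorants\<close>

lemma nondecreasing_within_unit:
  fixes F F' :: "real \<Rightarrow> real"
  assumes F': "\<And>t. t \<in> {0..1} \<Longrightarrow> (F has_real_derivative F' t) (at t within {0..1})"
    and ab: "0 \<le> a" "a \<le> b" "b \<le> 1" and nonneg: "\<And>t. a < t \<Longrightarrow> t < b \<Longrightarrow> 0 \<le> F' t"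
  shows "F a \<le> F b"
proof (rule DERIV_nonneg_imp_increasing_open[OF ab(2)])
  fix t assume t: "a < t" "t < b"
  have "(F has_real_derivative F' t) (at t)"
    using F'[of t] t ab by (simp add: at_within_Icc_at)
  then show "\<exists>y. (F has_real_derivative y) (at t) \<and> 0 \<le> y"
    using nonneg[OF t] by blast
next
  have "continuous_on {0..1} F"
    by (rule DERIV_continuous_on[OF F'])
  then show "continuous_on {a..b} F"
    by (rule continuous_on_subset) (use ab in auto)
qed

text \<open>\<open>F'\<close> is monotone, so \<open>F\<close> minus its tangent decreases up to
  \<open>x\<close> and increases from there on.\<close>

lemma tangent_le_within_unit:
  fixes F F' F'' :: "real \<Rightarrow> real"
  assumes F': "\<And>t. t \<in> {0..1} \<Longrightarrow> (F has_real_derivative F' t) (at t within {0..1})"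
    and F'': "\<And>t. t \<in> {0..1} \<Longrightarrow> (F' has_real_derivative F'' t) (at t within {0..1})"
    and nonneg: "\<And>t. t \<in> {0..1} \<Longrightarrow> 0 \<le> F'' t"
    and x: "x \<in> {0..1}" and t: "t \<in> {0..1}"
  shows "F x + F' x * (t - x) \<le> F t"
proof -
  have mono: "F' a \<le> F' b" if "0 \<le> a" "a \<le> b" "b \<le> 1" for a b
    by (rule nondecreasing_within_unit[OF F'' that]) (use that nonneg in auto)
  have G: "((\<lambda>s. F s - F' x * s) has_real_derivative F' s - F' x) (at s within {0..1})"
    "((\<lambda>s. F' x * s - F s) has_real_derivative F' x - F' s) (at s within {0..1})"
    if "s \<in> {0..1}" for s
    using that by (auto intro!: derivative_eq_intros F')
  show ?thesis
  proof (cases "x \<le> t")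
    case True
    have "F x - F' x * x \<le> F t - F' x * t"
      by (rule nondecreasing_within_unit[OF G(1)]) (use True x t in \<open>auto intro!: mono\<close>)
    then show ?thesis by (simp add: algebra_simps)
  next
    case False
    have "F' x * t - F t \<le> F' x * x - F x"
      by (rule nondecreasing_within_unit[OF G(2)]) (use False x t in \<open>auto intro!: mono\<close>)
    then show ?thesis by (simp add: algebra_simps)
  qed
qed

text \<open>The tangent at \<open>x\<close> lies below \<open>F\<close>, and its Bernstein sum is
  \<open>F x\<close> because the weights sum to one and the first central moment vanishes.\<close>

lemma Bernstein_jensen:
  fixes F F' F'' :: "real \<Rightarrow> real"
  assumes F': "\<And>t. t \<in> {0..1} \<Longrightarrow> (F has_real_derivative F' t) (at t within {0..1})"
    and F'': "\<And>t. t \<in> {0..1} \<Longrightarrow> (F' has_real_derivative F'' t) (at t within {0..1})"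
    and nonneg: "\<And>t. t \<in> {0..1} \<Longrightarrow> 0 \<le> F'' t"
    and x: "x \<in> {0..1}" and n: "n \<ge> 1"
  shows "F x \<le> (\<Sum>k\<le>n. Bernstein n k x * F (real k / real n))"
proof -
  have "(\<Sum>k\<le>n. Bernstein n k x * (F x + F' x * (real k / real n - x)))
      = F x * (\<Sum>k\<le>n. Bernstein n k x)
        + F' x / real n * (\<Sum>k\<le>n. Bernstein n k x * (real k - real n * x))"
    unfolding sum_distrib_left sum.distrib[symmetric]
    by (rule sum.cong) (use n in \<open>simp_all add: field_simps\<close>)
  also have "\<dots> = F x"
    by (simp add: Bernstein_central_moments)
  finally have "F x = (\<Sum>k\<le>n. Bernstein n k x * (F x + F' x * (real k / real n - x)))" ..
  also have "\<dots> \<le> (\<Sum>k\<le>n. Bernstein n k x * F (real k / real n))"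
  proof (intro sum_mono mult_left_mono)
    fix k assume "k \<in> {..n}"
    then show "F x + F' x * (real k / real n - x) \<le> F (real k / real n)"
      by (intro tangent_le_within_unit[OF F' F'' nonneg x]) (use n in auto)
    show "0 \<le> Bernstein n k x"
      using x by (intro Bernstein_nonneg) auto
  qed
  finally show ?thesis .
qed

text \<open>\<open>P\<close> is the majorant integrated twice from \<open>x\<close>, so
  \<open>P - f\<close> is convex and \<open>P x = 0\<close>. Jensen's inequality bounds the error of
  \<open>f\<close> by the Bernstein sum of \<open>P\<close>, which consists of the central moments
  of orders two to four.\<close>

lemma Bernstein_minus_le:
  fixes f f' f'' :: "real \<Rightarrow> real"
  assumes f': "\<And>t. t \<in> {0..1} \<Longrightarrow> (f has_real_derivative f' t) (at t within {0..1})"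
    and f'': "\<And>t. t \<in> {0..1} \<Longrightarrow> (f' has_real_derivative f'' t) (at t within {0..1})"
    and le: "\<And>t. t \<in> {0..1} \<Longrightarrow> f'' t \<le> a + l * (t - x) + c * (t - x)\<^sup>2"
    and x: "x \<in> {0..1}" and n: "n \<ge> 1"
  shows "real n * ((\<Sum>k\<le>n. Bernstein n k x * f (real k / real n)) - f x)
    \<le> x * (1 - x) * (a / 2 + l * (1 - 2 * x) / (6 * real n)
        + c * (3 * (real n - 2) * (x * (1 - x)) + 1) / (12 * (real n)\<^sup>2))"
proof -
  define P where "P = (\<lambda>t. a / 2 * (t - x)\<^sup>2 + l / 6 * (t - x) ^ 3 + c / 12 * (t - x) ^ 4)"
  define P' where "P' = (\<lambda>t. a * (t - x) + l / 2 * (t - x)\<^sup>2 + c / 3 * (t - x) ^ 3)"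
  have P': "(P has_real_derivative P' t) (at t within {0..1})" for t
    unfolding P_def P'_def by (auto intro!: derivative_eq_intros)
  have P'': "(P' has_real_derivative a + l * (t - x) + c * (t - x)\<^sup>2) (at t within {0..1})" for t
    unfolding P'_def by (auto intro!: derivative_eq_intros)
  have "P x - f x \<le> (\<Sum>k\<le>n. Bernstein n k x * (P (real k / real n) - f (real k / real n)))"
    by (rule Bernstein_jensen[where F' = "\<lambda>t. P' t - f' t"
          and F'' = "\<lambda>t. a + l * (t - x) + c * (t - x)\<^sup>2 - f'' t"])
      (use x n le in \<open>auto intro!: DERIV_diff P' P'' f' f''\<close>)
  then have "(\<Sum>k\<le>n. Bernstein n k x * f (real k / real n)) - f x
      \<le> (\<Sum>k\<le>n. Bernstein n k x * P (real k / real n))"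
    by (simp add: P_def right_diff_distrib sum_subtractf)
  also have "(\<Sum>k\<le>n. Bernstein n k x * P (real k / real n))
      = a / (2 * (real n)\<^sup>2) * (\<Sum>k\<le>n. Bernstein n k x * (real k - real n * x)\<^sup>2)
        + l / (6 * real n ^ 3) * (\<Sum>k\<le>n. Bernstein n k x * (real k - real n * x) ^ 3)
        + c / (12 * real n ^ 4) * (\<Sum>k\<le>n. Bernstein n k x * (real k - real n * x) ^ 4)"
    unfolding sum_distrib_left sum.distrib[symmetric]
  proof (rule sum.cong)
    fix k
    have "real k / real n - x = (real k - real n * x) / real n"
      using n by (simp add: field_simps)
    then show "Bernstein n k x * P (real k / real n) =
        a / (2 * (real n)\<^sup>2) * (Bernstein n k x * (real k - real n * x)\<^sup>2)
        + l / (6 * real n ^ 3) * (Bernstein n k x * (real k - real n * x) ^ 3)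
        + c / (12 * real n ^ 4) * (Bernstein n k x * (real k - real n * x) ^ 4)"
      unfolding P_def by (simp add: power_divide distrib_left mult.left_commute)
  qed simp
  finally have "real n * ((\<Sum>k\<le>n. Bernstein n k x * f (real k / real n)) - f x)
    \<le> real n * (a / (2 * (real n)\<^sup>2) * (real n * (x * (1 - x)))
        + l / (6 * real n ^ 3) * (real n * (x * (1 - x)) * (1 - 2 * x))
        + c / (12 * real n ^ 4) * (real n * (x * (1 - x)) * (3 * (real n - 2) * (x * (1 - x)) + 1)))"
    unfolding Bernstein_central_moments by (intro mult_left_mono) auto
  also have "\<dots> = x * (1 - x) * (a / 2 + l * (1 - 2 * x) / (6 * real n)
        + c * (3 * (real n - 2) * (x * (1 - x)) + 1) / (12 * (real n)\<^sup>2))"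
  proof -
    define N X Y D where "N = real n" and "X = x * (1 - x)" and "Y = 1 - 2 * x"
      and "D = 3 * (real n - 2) * (x * (1 - x)) + 1"
    have "N \<noteq> 0" using n unfolding N_def by simp
    then have "N * (a / (2 * N\<^sup>2) * (N * X) + l / (6 * N ^ 3) * (N * X * Y)
        + c / (12 * N ^ 4) * (N * X * D)) = X * (a / 2 + l * Y / (6 * N) + c * D / (12 * N\<^sup>2))"
      by (simp add: field_simps power2_eq_square power3_eq_cube power4_eq_xxxx)
    then show ?thesis
      unfolding N_def X_def D_def Y_def by simp
  qed
  finally show ?thesis .
qed

text \<open>The left-hand side is the derivative at \<open>x\<close> of the Bernstein polynomial of degree \<open>Suc m\<close>.\<close>
lemma Bernstein_differences_le:
  fixes f f' :: "real \<Rightarrow> real"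
  assumes f': "\<And>t. t \<in> {0..1} \<Longrightarrow> (f has_real_derivative f' t) (at t within {0..1})"
    and le: "\<And>t. t \<in> {0..1} \<Longrightarrow> f' t \<le> a + l * (t - x) + c * (t - x)\<^sup>2"
    and x: "x \<in> {0..1}" and n: "n = Suc m"
  shows "(\<Sum>k\<le>m. Bernstein m k x * (real n * (f (real (Suc k) / real n) - f (real k / real n))))
    \<le> a + l * (1 - 2 * x) / (2 * real n) + c * ((real n - 2) * (x * (1 - x)) + 1 / 3) / (real n)\<^sup>2"
proof -
  \<comment> \<open>The majorant integrated once from \<open>x\<close>: \<open>P - f\<close> is
    nondecreasing, so every forward difference of \<open>f\<close> is at most that of
    \<open>P\<close>.\<close>
  define P where "P = (\<lambda>t. a * (t - x) + l / 2 * (t - x)\<^sup>2 + c / 3 * (t - x) ^ 3)"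
  define N where "N = real n"
  have N: "0 < N" "N = real m + 1"
    using n unfolding N_def by auto
  have P': "(P has_real_derivative a + l * (t - x) + c * (t - x)\<^sup>2) (at t within {0..1})" for t
    unfolding P_def by (auto intro!: derivative_eq_intros)
  have "(\<Sum>k\<le>m. Bernstein m k x * (N * (f (real (Suc k) / N) - f (real k / N))))
    \<le> (\<Sum>k\<le>m. Bernstein m k x * (N * (P (real (Suc k) / N) - P (real k / N))))"
  proof (intro sum_mono mult_left_mono)
    fix k assume k: "k \<in> {..m}"
    have "P (real k / N) - f (real k / N) \<le> P (real (Suc k) / N) - f (real (Suc k) / N)"
    proof (rule nondecreasing_within_unit[where F = "\<lambda>t. P t - f t"
          and F' = "\<lambda>t. a + l * (t - x) + c * (t - x)\<^sup>2 - f' t"])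
      show "real k / N \<le> real (Suc k) / N" "real (Suc k) / N \<le> 1" "0 \<le> real k / N"
        using N k by (simp_all add: divide_right_mono)
      then show "0 \<le> a + l * (t - x) + c * (t - x)\<^sup>2 - f' t"
        if "real k / N < t" "t < real (Suc k) / N" for t
        using le[of t] that by auto
    qed (auto intro!: DERIV_diff P' f')
    then show "f (real (Suc k) / N) - f (real k / N) \<le> P (real (Suc k) / N) - P (real k / N)"
      by simp
    show "0 \<le> Bernstein m k x"
      using x by (intro Bernstein_nonneg) auto
  qed (use N in auto)
  also have "\<dots> = (a + l * (1 - 2 * x) / (2 * N) + c * (1 - 3 * (x * (1 - x))) / (3 * N\<^sup>2))
          * (\<Sum>k\<le>m. Bernstein m k x)
        + (l / N + c * (1 - 2 * x) / N\<^sup>2) * (\<Sum>k\<le>m. Bernstein m k x * (real k - real m * x))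
        + c / N\<^sup>2 * (\<Sum>k\<le>m. Bernstein m k x * (real k - real m * x)\<^sup>2)"
    unfolding sum_distrib_left sum.distrib[symmetric]
  proof (rule sum.cong)
    fix k
    \<comment> \<open>The weights have degree \<open>m = n - 1\<close>, so the expansion is centred
      at \<open>real m * x\<close>, while the nodes have denominator \<open>n\<close>; this causes
      the shifts \<open>u - x\<close> and \<open>u + 1 - x\<close>.\<close>
    define u where "u = real k - real m * x"
    have u: "real k / N - x = (u - x) / N" "real (Suc k) / N - x = (u + 1 - x) / N"
      using N unfolding u_def by (simp_all add: field_simps)
    have diff: "N * (P (real (Suc k) / N) - P (real k / N))
      = (a + l * (1 - 2 * x) / (2 * N) + c * (1 - 3 * (x * (1 - x))) / (3 * N\<^sup>2))
        + (l / N + c * (1 - 2 * x) / N\<^sup>2) * u + c / N\<^sup>2 * u\<^sup>2"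
      unfolding P_def u using N(1) by (simp add: field_simps power2_eq_square power3_eq_cube)
    show "Bernstein m k x * (N * (P (real (Suc k) / N) - P (real k / N)))
      = (a + l * (1 - 2 * x) / (2 * N) + c * (1 - 3 * (x * (1 - x))) / (3 * N\<^sup>2)) * Bernstein m k x
        + (l / N + c * (1 - 2 * x) / N\<^sup>2) * (Bernstein m k x * (real k - real m * x))
        + c / N\<^sup>2 * (Bernstein m k x * (real k - real m * x)\<^sup>2)"
      unfolding diff u_def[symmetric] by (simp add: algebra_simps)
  qed simp
  also have "\<dots> = a + l * (1 - 2 * x) / (2 * N) + c * ((N - 2) * (x * (1 - x)) + 1 / 3) / N\<^sup>2"
  proof -
    define X where "X = x * (1 - x)"
    have "c * (1 - 3 * X) / (3 * N\<^sup>2) + c / N\<^sup>2 * (real m * X) = c * ((N - 2) * X + 1 / 3) / N\<^sup>2"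
      using N(1) unfolding \<open>N = real m + 1\<close> by (simp add: field_simps)
    then show ?thesis
      unfolding Bernstein_central_moments X_def by simp
  qed
  finally show ?thesis
    unfolding N_def .
qed

section \<open>Moduli of continuity and the sup norm as true bounds\<close>

lemma bounded_continuous_unit:
  fixes g :: "real \<Rightarrow> real"
  assumes "continuous_on {0..1} g"
  shows "\<exists>M. \<forall>t\<in>{0..1}. \<bar>g t\<bar> \<le> M"
proof -
  have "bounded (g ` {0..1})"
    by (rule compact_imp_bounded[OF compact_continuous_image[OF assms]]) simp
  then show ?thesis
    unfolding bounded_iff by auto
qed

lemma abs_le_sup_norm:
  assumes "continuous_on {0..1} g" "t \<in> {0..1}"
  shows "\<bar>g t\<bar> \<le> sup_norm g"
proof -
  obtain M where "\<And>t. t \<in> {0..1} \<Longrightarrow> \<bar>g t\<bar> \<le> M"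
    using bounded_continuous_unit[OF assms(1)] by blast
  then have "bdd_above ((\<lambda>t. \<bar>g t\<bar>) ` {0..1})"
    by (rule bdd_aboveI2)
  then show ?thesis
    unfolding sup_norm_def using assms(2) by (intro cSUP_upper) auto
qed

lemma abs_diff_le_modulus1:
  assumes "continuous_on {0..1} g" "s \<in> {0..1}" "t \<in> {0..1}" "\<bar>s - t\<bar> \<le> \<delta>"
  shows "\<bar>g s - g t\<bar> \<le> modulus1 g \<delta>"
  unfolding modulus1_def
proof (rule cSup_upper)
  obtain M where M: "\<And>t. t \<in> {0..1} \<Longrightarrow> \<bar>g t\<bar> \<le> M"
    using bounded_continuous_unit[OF assms(1)] by blast
  have "\<bar>g s - g t\<bar> \<le> 2 * M" if "s \<in> {0..1}" "t \<in> {0..1}" for s t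
    using M[OF that(1)] M[OF that(2)] by linarith
  then show "bdd_above {\<bar>g s - g t\<bar> | s t. s \<in> {0..1} \<and> t \<in> {0..1} \<and> \<bar>s - t\<bar> \<le> \<delta>}"
    by (intro bdd_aboveI[of _ "2 * M"]) blast
qed (use assms in blast)

lemma abs_second_diff_le:
  assumes cont: "continuous_on {0..1} g" and h: "0 \<le> h" "h \<le> \<delta>"
    and t: "t - h \<in> {0..1}" "t + h \<in> {0..1}"
  shows "\<bar>g (t - h) - 2 * g t + g (t + h)\<bar> \<le> 2 * modulus1 g \<delta>"
proof -
  have "\<bar>g (t - h) - g t\<bar> \<le> modulus1 g \<delta>" "\<bar>g (t + h) - g t\<bar> \<le> modulus1 g \<delta>"
    by (rule abs_diff_le_modulus1[OF cont]; use h t in auto)+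
  then show ?thesis by linarith
qed

text \<open>Lets the second-order part of the slope bound be absorbed into the first modulus, and
  shows that modulus to be nonnegative.\<close>

lemma modulus2_le_modulus1:
  assumes "continuous_on {0..1} g" "0 \<le> \<delta>"
  shows "modulus2 g \<delta> \<le> 2 * modulus1 g \<delta>"
  unfolding modulus2_def
proof (rule cSup_least)
  have "\<bar>g (0 - 0) - 2 * g 0 + g (0 + 0)\<bar> \<in> {\<bar>g (t - h) - 2 * g t + g (t + h)\<bar> | t h.
            0 \<le> h \<and> h \<le> \<delta> \<and> t - h \<in> {0..1} \<and> t + h \<in> {0..1}}"
    using assms(2) by force
  then show "{\<bar>g (t - h) - 2 * g t + g (t + h)\<bar> | t h.
            0 \<le> h \<and> h \<le> \<delta> \<and> t - h \<in> {0..1} \<and> t + h \<in> {0..1}} \<noteq> {}"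
    by blast
qed (use abs_second_diff_le[OF assms(1)] in blast)

lemma second_diff_le_modulus2:
  assumes "continuous_on {0..1} g" "h \<le> \<delta>"
  shows "second_diff_le g h (modulus2 g \<delta>)"
  unfolding second_diff_le_def modulus2_def
proof (intro allI impI cSup_upper)
  show "bdd_above {\<bar>g (t - h) - 2 * g t + g (t + h)\<bar> | t h.
            0 \<le> h \<and> h \<le> \<delta> \<and> t - h \<in> {0..1} \<and> t + h \<in> {0..1}}"
    by (rule bdd_aboveI[of _ "2 * modulus1 g \<delta>"])
      (use abs_second_diff_le[OF assms(1)] in blast)
next
  fix t d assume *: "0 \<le> d" "d \<le> h" "t - d \<in> {0..1}" "t + d \<in> {0..1}"
  then have "d \<le> \<delta>" using assms(2) by simp
  with * show "\<bar>g (t - d) - 2 * g t + g (t + d)\<bar> \<in> {\<bar>g (t - h) - 2 * g t + g (t + h)\<bar> | t h.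
            0 \<le> h \<and> h \<le> \<delta> \<and> t - h \<in> {0..1} \<and> t + h \<in> {0..1}}"
    by blast
qed

section \<open>Deviation estimates for the two functionals\<close>

text \<open>\<open>Bernstein_minus_le\<close> with the majorant \<open>a = f'' x + w\<close>,
  \<open>c = w / (2 * h\<^sup>2)\<close>; the part \<open>f'' x / 2\<close> is the limit term.
  Applying the same to \<open>- f\<close> gives the lower bound.\<close>

lemma Bernstein_voronovskaya:
  fixes f f' f'' :: "real \<Rightarrow> real"
  assumes f': "\<And>t. t \<in> {0..1} \<Longrightarrow> (f has_real_derivative f' t) (at t within {0..1})"
    and f'': "\<And>t. t \<in> {0..1} \<Longrightarrow> (f' has_real_derivative f'' t) (at t within {0..1})"
    and cont: "continuous_on {0..1} f''" and h: "0 < h" "h \<le> 1 / 2"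
    and d2: "second_diff_le f'' h w"
    and W: "\<And>s t. s \<in> {0..1} \<Longrightarrow> t \<in> {0..1} \<Longrightarrow> \<bar>s - t\<bar> \<le> h \<Longrightarrow> \<bar>f'' s - f'' t\<bar> \<le> W"
    and x: "x \<in> {0..1}" and n: "n \<ge> 1"
  shows "\<bar>real n * ((\<Sum>k\<le>n. Bernstein n k x * f (real k / real n)) - f x)
            - x * (1 - x) / 2 * f'' x\<bar>
    \<le> x * (1 - x) * (\<bar>1 - 2 * x\<bar> * (W + w / 2) / (6 * real n * h)
        + w / 2 * (1 + (3 * (real n - 2) * (x * (1 - x)) + 1) / (12 * (real n * h)\<^sup>2)))"
proof -
  have upper: "real n * ((\<Sum>k\<le>n. Bernstein n k x * f (real k / real n)) - f x)
            - x * (1 - x) / 2 * f'' x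
    \<le> x * (1 - x) * (\<bar>1 - 2 * x\<bar> * (W + w / 2) / (6 * real n * h)
        + w / 2 * (1 + (3 * (real n - 2) * (x * (1 - x)) + 1) / (12 * (real n * h)\<^sup>2)))"
    if f': "\<And>t. t \<in> {0..1} \<Longrightarrow> (f has_real_derivative f' t) (at t within {0..1})"
      and f'': "\<And>t. t \<in> {0..1} \<Longrightarrow> (f' has_real_derivative f'' t) (at t within {0..1})"
      and cont: "continuous_on {0..1} f''" and d2: "second_diff_le f'' h w"
      and W: "\<And>s t. s \<in> {0..1} \<Longrightarrow> t \<in> {0..1} \<Longrightarrow> \<bar>s - t\<bar> \<le> h \<Longrightarrow> \<bar>f'' s - f'' t\<bar> \<le> W"
    for f f' f'' :: "real \<Rightarrow> real"
  proof -
    define D where "D = 3 * (real n - 2) * (x * (1 - x)) + 1"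
    obtain l where l: "l * (1 - 2 * x) \<le> \<bar>1 - 2 * x\<bar> * ((W + w / 2) / h)"
      and le: "\<And>t. t \<in> {0..1} \<Longrightarrow> f'' t \<le> f'' x + l * (t - x) + (1 + (t - x)\<^sup>2 / (2 * h\<^sup>2)) * w"
      using quadratic_majorant[OF cont h d2 x W] by blast
    have "real n * ((\<Sum>k\<le>n. Bernstein n k x * f (real k / real n)) - f x)
      \<le> x * (1 - x) * ((f'' x + w) / 2 + l * (1 - 2 * x) / (6 * real n)
          + w / (2 * h\<^sup>2) * D / (12 * (real n)\<^sup>2))"
      unfolding D_def
      by (rule Bernstein_minus_le[OF f' f'' _ x n]) (use le in \<open>auto simp: algebra_simps\<close>)
    also have "\<dots> \<le> x * (1 - x) * ((f'' x + w) / 2 + \<bar>1 - 2 * x\<bar> * ((W + w / 2) / h) / (6 * real n)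
          + w / (2 * h\<^sup>2) * D / (12 * (real n)\<^sup>2))"
      using l x n by (intro mult_left_mono add_right_mono add_left_mono divide_right_mono) auto
    also have "\<dots> = x * (1 - x) / 2 * f'' x + x * (1 - x) * (\<bar>1 - 2 * x\<bar> * (W + w / 2) / (6 * real n * h)
        + w / 2 * (1 + D / (12 * (real n * h)\<^sup>2)))"
      by (simp add: algebra_simps add_divide_distrib power_mult_distrib)
    finally show ?thesis
      unfolding D_def by simp
  qed
  have W': "\<bar>- f'' s - - f'' t\<bar> \<le> W" if "s \<in> {0..1}" "t \<in> {0..1}" "\<bar>s - t\<bar> \<le> h" for s t
    using W[OF that] by linarith
  note upper[OF f' f'' cont d2 W]
  moreover note upper[OF DERIV_minus[OF f'] DERIV_minus[OF f''] continuous_on_minus[OF cont]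
      second_diff_le_uminus[OF d2] W']
  ultimately show ?thesis
    by (simp add: abs_le_iff sum_negf right_diff_distrib)
qed

text \<open>The analogue one derivative lower, with the majorant of \<open>f'\<close> fed into
  \<open>Bernstein_differences_le\<close>.\<close>

lemma Bernstein_differences_deviation:
  fixes f f' :: "real \<Rightarrow> real"
  assumes f': "\<And>t. t \<in> {0..1} \<Longrightarrow> (f has_real_derivative f' t) (at t within {0..1})"
    and cont: "continuous_on {0..1} f'" and h: "0 < h" "h \<le> 1 / 2"
    and d2: "second_diff_le f' h w"
    and W: "\<And>s t. s \<in> {0..1} \<Longrightarrow> t \<in> {0..1} \<Longrightarrow> \<bar>s - t\<bar> \<le> h \<Longrightarrow> \<bar>f' s - f' t\<bar> \<le> W"
    and x: "x \<in> {0..1}" and n: "n = Suc m"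
  shows "\<bar>(\<Sum>k\<le>m. Bernstein m k x * (real n * (f (real (Suc k) / real n) - f (real k / real n)))) - f' x\<bar>
    \<le> \<bar>1 - 2 * x\<bar> * (W + w / 2) / (2 * real n * h)
        + w * (1 + ((real n - 2) * (x * (1 - x)) + 1 / 3) / (2 * (real n * h)\<^sup>2))"
proof -
  have upper: "(\<Sum>k\<le>m. Bernstein m k x * (real n * (f (real (Suc k) / real n) - f (real k / real n)))) - f' x
    \<le> \<bar>1 - 2 * x\<bar> * (W + w / 2) / (2 * real n * h)
        + w * (1 + ((real n - 2) * (x * (1 - x)) + 1 / 3) / (2 * (real n * h)\<^sup>2))"
    if f': "\<And>t. t \<in> {0..1} \<Longrightarrow> (f has_real_derivative f' t) (at t within {0..1})"
      and cont: "continuous_on {0..1} f'" and d2: "second_diff_le f' h w"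
      and W: "\<And>s t. s \<in> {0..1} \<Longrightarrow> t \<in> {0..1} \<Longrightarrow> \<bar>s - t\<bar> \<le> h \<Longrightarrow> \<bar>f' s - f' t\<bar> \<le> W"
    for f f' :: "real \<Rightarrow> real"
  proof -
    define D where "D = (real n - 2) * (x * (1 - x)) + 1 / 3"
    obtain l where l: "l * (1 - 2 * x) \<le> \<bar>1 - 2 * x\<bar> * ((W + w / 2) / h)"
      and le: "\<And>t. t \<in> {0..1} \<Longrightarrow> f' t \<le> f' x + l * (t - x) + (1 + (t - x)\<^sup>2 / (2 * h\<^sup>2)) * w"
      using quadratic_majorant[OF cont h d2 x W] by blast
    have "(\<Sum>k\<le>m. Bernstein m k x * (real n * (f (real (Suc k) / real n) - f (real k / real n))))
      \<le> (f' x + w) + l * (1 - 2 * x) / (2 * real n) + w / (2 * h\<^sup>2) * D / (real n)\<^sup>2"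
      unfolding D_def
      by (rule Bernstein_differences_le[OF f' _ x n]) (use le in \<open>auto simp: algebra_simps\<close>)
    also have "\<dots> \<le> (f' x + w) + \<bar>1 - 2 * x\<bar> * ((W + w / 2) / h) / (2 * real n)
          + w / (2 * h\<^sup>2) * D / (real n)\<^sup>2"
      using l n by (intro add_right_mono add_left_mono divide_right_mono) auto
    also have "\<dots> = f' x + \<bar>1 - 2 * x\<bar> * (W + w / 2) / (2 * real n * h)
        + w * (1 + D / (2 * (real n * h)\<^sup>2))"
      by (simp add: algebra_simps add_divide_distrib power_mult_distrib)
    finally show ?thesis
      unfolding D_def by simp
  qed
  have W': "\<bar>- f' s - - f' t\<bar> \<le> W" if "s \<in> {0..1}" "t \<in> {0..1}" "\<bar>s - t\<bar> \<le> h" for s t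
    using W[OF that] by linarith
  have neg: "(\<Sum>k\<le>m. Bernstein m k x * (real n * (- f (real (Suc k) / real n) - - f (real k / real n))))
    = - (\<Sum>k\<le>m. Bernstein m k x * (real n * (f (real (Suc k) / real n) - f (real k / real n))))"
    unfolding sum_negf[symmetric] by (rule sum.cong) (auto simp: algebra_simps)
  note upper[OF f' cont d2 W]
  moreover note upper[OF DERIV_minus[OF f'] continuous_on_minus[OF cont]
      second_diff_le_uminus[OF d2] W', unfolded neg]
  ultimately show ?thesis
    by (simp add: abs_le_iff)
qed

text \<open>The constant majorant \<open>M\<close>, that is \<open>l = c = 0\<close>, for
  \<open>f\<close> and for \<open>- f\<close>.\<close>

lemma abs_Bernstein_differences_le:
  fixes f f' :: "real \<Rightarrow> real"
  assumes f': "\<And>t. t \<in> {0..1} \<Longrightarrow> (f has_real_derivative f' t) (at t within {0..1})"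
    and M: "\<And>t. t \<in> {0..1} \<Longrightarrow> \<bar>f' t\<bar> \<le> M" and x: "x \<in> {0..1}" and n: "n = Suc m"
  shows "\<bar>\<Sum>k\<le>m. Bernstein m k x * (real n * (f (real (Suc k) / real n) - f (real k / real n)))\<bar> \<le> M"
proof -
  have "(\<Sum>k\<le>m. Bernstein m k x * (real n * (f (real (Suc k) / real n) - f (real k / real n))))
    \<le> M + 0 * (1 - 2 * x) / (2 * real n) + 0 * ((real n - 2) * (x * (1 - x)) + 1 / 3) / (real n)\<^sup>2"
    by (rule Bernstein_differences_le[OF f' _ x n]) (use M in \<open>auto simp: abs_le_iff\<close>)
  moreover have "(\<Sum>k\<le>m. Bernstein m k x * (real n * (- f (real (Suc k) / real n) - - f (real k / real n))))
    \<le> M + 0 * (1 - 2 * x) / (2 * real n) + 0 * ((real n - 2) * (x * (1 - x)) + 1 / 3) / (real n)\<^sup>2"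
    by (rule Bernstein_differences_le[OF DERIV_minus[OF f'] _ x n]) (use M in \<open>auto simp: abs_le_iff\<close>)
  moreover have "(\<Sum>k\<le>m. Bernstein m k x * (real n * (- f (real (Suc k) / real n) - - f (real k / real n))))
    = - (\<Sum>k\<le>m. Bernstein m k x * (real n * (f (real (Suc k) / real n) - f (real k / real n))))"
    unfolding sum_negf[symmetric] by (rule sum.cong) (auto simp: algebra_simps)
  ultimately show ?thesis
    by (simp add: abs_le_iff)
qed

section \<open>Comparison with the classical operator and the final estimate\<close>

text \<open>With \<open>a0 n = (1 - a1 n) / 2\<close> the two coefficients differ from
  \<open>1 - x\<close> and \<open>x\<close> by \<open>(1 + a1 n) * (1 - 2 * x) / 2\<close>, with a
  minus sign at index \<open>k\<close> and a plus sign at \<open>Suc k\<close>; the surplus is a sum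
  of forward differences.\<close>

lemma mod_bernstein_op_eq:
  assumes a: "2 * a0 n + a1 n = 1" and n: "n = Suc m"
  shows "real n * mod_bernstein_op a0 a1 n f x
    = real n * (\<Sum>k\<le>n. Bernstein n k x * f (real k / real n))
      + (1 + a1 n) * (1 - 2 * x) / 2
        * (\<Sum>k\<le>m. Bernstein m k x * (real n * (f (real (Suc k) / real n) - f (real k / real n))))"
proof -
  have a0: "a0 n = (1 - a1 n) / 2"
    using a by simp
  show ?thesis
    unfolding mod_bernstein_op_def mod_bernstein_basis_def n diff_Suc_1
      sum_bernstein_basis_split sum_Bernstein_Suc
    unfolding n[symmetric] sum_distrib_left sum.distrib[symmetric] mod_coeff_def a0
    by (rule sum.cong) (auto simp: field_simps)
qed

theorem theorem4p2:
  fixes a0 a1 :: "nat \<Rightarrow> real" and L1 :: real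
    and f f' f'' :: "real \<Rightarrow> real"
    and x X X' :: real and n :: nat
  assumes a: "\<And>m. m \<ge> 1 \<Longrightarrow> 2 * a0 m + a1 m = 1"
    and L1: "a1 \<longlonglongrightarrow> L1"
    and f': "\<And>t. t \<in> {0..1} \<Longrightarrow> (f has_real_derivative f' t) (at t within {0..1})"
    and f'': "\<And>t. t \<in> {0..1} \<Longrightarrow> (f' has_real_derivative f'' t) (at t within {0..1})"
    and cont: "continuous_on {0..1} f''"
    and x: "x \<in> {0..1}"
    and n: "n \<ge> 1"
    and X: "X = x * (1 - x)"
    and X': "X' = 1 - 2 * x"
  shows "\<bar>real n * (mod_bernstein_op a0 a1 n f x - f x)
            - x * (1 - x) / 2 * f'' x - (1 - 2 * x) / 2 * (1 + L1) * f' x\<bar>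
    \<le> X * (5 / 6 * (\<bar>X'\<bar> / sqrt (3 * (real n - 2) * X + 1))
              * modulus1 f'' (sqrt ((3 * (real n - 2) * X + 1) / (real n)\<^sup>2))
            + 13 / 16 * modulus2 f'' (sqrt ((3 * (real n - 2) * X + 1) / (real n)\<^sup>2)))
      + \<bar>X'\<bar> / 2 * (\<bar>L1 - a1 n\<bar> * sup_norm f'
            + \<bar>1 + L1\<bar> * (13 / 4 * modulus2 f' (1 / sqrt (real n))
                + 1 / sqrt (real n) * modulus1 f' (1 / sqrt (real n))))"
proof -
  obtain m where m: "n = Suc m"
    using n by (cases n) auto
  have cont': "continuous_on {0..1} f'"
    by (rule DERIV_continuous_on[OF f''])
  define B where "B = (\<Sum>k\<le>n. Bernstein n k x * f (real k / real n))"
  define K where "K = (\<Sum>k\<le>m. Bernstein m k x *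
    (real n * (f (real (Suc k) / real n) - f (real k / real n))))"
  define D where "D = 3 * (real n - 2) * X + 1"
  have X01: "0 \<le> X" "X \<le> 1 / 4"
    using x zero_le_power2[of "x - 1 / 2"] unfolding X
    by (simp, simp add: power2_eq_square algebra_simps)
  \<comment> \<open>For \<open>n = 1\<close> the factor \<open>real n - 2\<close> is negative and
    \<open>D = 1 - 3 * X\<close>, which lies between \<open>1 / 4\<close> and \<open>1\<close>. The
    upper bound keeps the argument of the moduli of \<open>f''\<close> at most 1.\<close>
  have D: "0 < D" "D \<le> (real n)\<^sup>2"
  proof -
    have "n = 1 \<or> n \<ge> 2" using n by linarith
    then have "0 < D \<and> D \<le> (real n)\<^sup>2"
    proof
      assume "n = 1"
      then show ?thesis unfolding D_def using X01 by simp
    next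
      assume n2: "n \<ge> 2"
      then have "(real n - 2) * X \<le> (real n - 2) * (1 / 4)" "0 \<le> (real n - 2) * X"
        using X01 by (intro mult_left_mono mult_nonneg_nonneg; simp)+
      moreover have "2 \<le> real n" "2 * real n \<le> (real n)\<^sup>2"
        using n2 by (simp_all add: power2_eq_square)
      ultimately show ?thesis
        unfolding D_def mult.assoc[of 3] by simp
    qed
    then show "0 < D" "D \<le> (real n)\<^sup>2" by auto
  qed
  have part1: "\<bar>real n * (B - f x) - x * (1 - x) / 2 * f'' x\<bar>
    \<le> X * (5 / 6 * (\<bar>X'\<bar> / sqrt D) * modulus1 f'' (sqrt (D / (real n)\<^sup>2))
            + 13 / 16 * modulus2 f'' (sqrt (D / (real n)\<^sup>2)))"
  proof -
    define \<delta> where "\<delta> = sqrt (D / (real n)\<^sup>2)"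
    define W w where "W = modulus1 f'' \<delta>" and "w = modulus2 f'' \<delta>"
    have n\<delta>: "real n * \<delta> = sqrt D"
      using n unfolding \<delta>_def by (simp add: real_sqrt_divide)
    have \<delta>: "0 < \<delta>" "\<delta> \<le> 1"
      using D n unfolding \<delta>_def by auto
    have d2: "second_diff_le f'' (\<delta> / 2) w"
      unfolding w_def by (rule second_diff_le_modulus2[OF cont]) (use \<delta> in auto)
    have w: "0 \<le> w" "w \<le> 2 * W"
      using second_diff_le_nonneg[OF d2] modulus2_le_modulus1[OF cont] \<delta> unfolding w_def W_def by auto
    have "\<bar>real n * (B - f x) - x * (1 - x) / 2 * f'' x\<bar>
      \<le> x * (1 - x) * (\<bar>1 - 2 * x\<bar> * (W + w / 2) / (6 * real n * (\<delta> / 2))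
        + w / 2 * (1 + (3 * (real n - 2) * (x * (1 - x)) + 1) / (12 * (real n * (\<delta> / 2))\<^sup>2)))"
      unfolding B_def
    proof (rule Bernstein_voronovskaya[OF f' f'' cont _ _ d2 _ x n])
      show "\<bar>f'' s - f'' t\<bar> \<le> W" if "s \<in> {0..1}" "t \<in> {0..1}" "\<bar>s - t\<bar> \<le> \<delta> / 2" for s t
        unfolding W_def by (rule abs_diff_le_modulus1[OF cont]) (use that \<delta> in auto)
    qed (use \<delta> in auto)
    also have "\<dots> = X * (\<bar>X'\<bar> * (W + w / 2) / (3 * sqrt D) + w / 2 * (1 + D / (3 * (sqrt D)\<^sup>2)))"
      unfolding X[symmetric] X'[symmetric] D_def[symmetric] n\<delta>[symmetric]
      by (simp add: power_divide)
    \<comment> \<open>The step \<open>h = \<delta> / 2\<close> with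
      \<open>n * \<delta> = sqrt D\<close> turns the quadratic contribution into
      \<open>1 / 3\<close>, so the coefficient of \<open>w\<close> is \<open>2 / 3\<close>, below
      \<open>13 / 16\<close>.\<close>
    also have "\<dots> = X * (\<bar>X'\<bar> / sqrt D * (W + w / 2) / 3 + 2 / 3 * w)"
      using D by simp
    also have "\<dots> \<le> X * (5 / 6 * (\<bar>X'\<bar> / sqrt D) * W + 13 / 16 * w)"
    proof (rule mult_left_mono[OF _ X01(1)])
      \<comment> \<open>\<open>w \<le> 2 * W\<close> even gives the factor 2; \<open>5 / 2\<close>
        divided by 3 is the stated \<open>5 / 6\<close>.\<close>
      have "\<bar>X'\<bar> / sqrt D * (W + w / 2) \<le> \<bar>X'\<bar> / sqrt D * (5 / 2 * W)"
        using w D by (intro mult_left_mono) auto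
      then show "\<bar>X'\<bar> / sqrt D * (W + w / 2) / 3 + 2 / 3 * w \<le> 5 / 6 * (\<bar>X'\<bar> / sqrt D) * W + 13 / 16 * w"
        using w by simp
    qed
    finally show ?thesis
      unfolding W_def w_def \<delta>_def .
  qed
  have part2: "\<bar>K - f' x\<bar> \<le> 13 / 4 * modulus2 f' (1 / sqrt (real n))
                + 1 / sqrt (real n) * modulus1 f' (1 / sqrt (real n))"
  proof -
    define \<delta> where "\<delta> = 1 / sqrt (real n)"
    define W w where "W = modulus1 f' \<delta>" and "w = modulus2 f' \<delta>"
    define E where "E = (real n - 2) * X + 1 / 3"
    have \<delta>: "0 < \<delta>" "\<delta> \<le> 1"
      using n unfolding \<delta>_def by auto
    have n\<delta>: "real n * \<delta> = sqrt (real n)" "1 / sqrt (real n) = \<delta>"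
      using n unfolding \<delta>_def by (simp_all add: real_div_sqrt)
    have d2: "second_diff_le f' (\<delta> / 2) w"
      unfolding w_def by (rule second_diff_le_modulus2[OF cont']) (use \<delta> in auto)
    have w: "0 \<le> w" "0 \<le> W"
      using second_diff_le_nonneg[OF d2] modulus2_le_modulus1[OF cont', of \<delta>] \<delta>
      unfolding w_def W_def by auto
    \<comment> \<open>For \<open>n = 1\<close> this is \<open>1 / 3 - X \<le> 1 / 3\<close>; for
      \<open>n \<ge> 2\<close> it follows from \<open>X \<le> 1 / 4\<close>.\<close>
    have E: "E \<le> real n / 3"
    proof -
      have "n = 1 \<or> n \<ge> 2" using n by linarith
      then show ?thesis
      proof
        assume "n = 1"
        then show ?thesis unfolding E_def using X01 by simp
      next
        assume n2: "n \<ge> 2"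
        then have "(real n - 2) * X \<le> (real n - 2) * (1 / 4)"
          using X01 by (intro mult_left_mono) auto
        then have "E \<le> (real n - 2) / 4 + 1 / 3"
          unfolding E_def by simp
        then show ?thesis
          using of_nat_0_le_iff[of n, where 'a = real] by argo
      qed
    qed
    have "\<bar>K - f' x\<bar> \<le> \<bar>1 - 2 * x\<bar> * (W + w / 2) / (2 * real n * (\<delta> / 2))
        + w * (1 + ((real n - 2) * (x * (1 - x)) + 1 / 3) / (2 * (real n * (\<delta> / 2))\<^sup>2))"
      unfolding K_def
    proof (rule Bernstein_differences_deviation[OF f' cont' _ _ d2 _ x m])
      show "\<bar>f' s - f' t\<bar> \<le> W" if "s \<in> {0..1}" "t \<in> {0..1}" "\<bar>s - t\<bar> \<le> \<delta> / 2" for s t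
        unfolding W_def by (rule abs_diff_le_modulus1[OF cont']) (use that \<delta> in auto)
    qed (use \<delta> in auto)
    also have "\<dots> = \<bar>X'\<bar> * (W + w / 2) * \<delta> + w * (1 + 2 * (E / real n))"
      unfolding X[symmetric] X'[symmetric] E_def[symmetric]
    proof -
      have eq: "2 * real n * (\<delta> / 2) = sqrt (real n)" "2 * (real n * (\<delta> / 2))\<^sup>2 = real n / 2"
        using n\<delta>(1) by (simp_all add: power_divide)
      show "\<bar>X'\<bar> * (W + w / 2) / (2 * real n * (\<delta> / 2)) + w * (1 + E / (2 * (real n * (\<delta> / 2))\<^sup>2))
         = \<bar>X'\<bar> * (W + w / 2) * \<delta> + w * (1 + 2 * (E / real n))"
        unfolding eq by (simp add: \<delta>_def)
    qed
    also have "\<dots> \<le> 1 * (W + w / 2) * \<delta> + w * (1 + 2 * (1 / 3))"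
      using E n w \<delta> x unfolding X'
      by (intro add_mono mult_left_mono mult_right_mono) (auto simp: field_simps)
    \<comment> \<open>As \<open>\<delta> \<le> 1\<close>, the coefficient of \<open>w\<close> is at
      most \<open>1 / 2 + 5 / 3 = 13 / 6\<close>.\<close>
    also have "\<dots> \<le> 13 / 4 * w + \<delta> * W"
      using mult_right_mono[OF \<delta>(2) w(1)] w by (simp add: algebra_simps)
    finally show ?thesis
      unfolding n\<delta>(2) W_def w_def .
  qed
  have "\<bar>K\<bar> \<le> sup_norm f'"
    unfolding K_def by (rule abs_Bernstein_differences_le[OF f' abs_le_sup_norm[OF cont'] x m])
  \<comment> \<open>\<open>1 + a1 n\<close> is split at \<open>L1\<close>. Pairing
    \<open>a1 n - L1\<close> with \<open>K\<close> instead of \<open>f' x\<close> leaves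
    \<open>K - f' x\<close> with the factor \<open>1 + L1\<close> of the claim.\<close>
  then have "\<bar>(a1 n - L1) * K + (1 + L1) * (K - f' x)\<bar>
      \<le> \<bar>L1 - a1 n\<bar> * sup_norm f' + \<bar>1 + L1\<bar> * (13 / 4 * modulus2 f' (1 / sqrt (real n))
                + 1 / sqrt (real n) * modulus1 f' (1 / sqrt (real n)))"
    using part2 by (intro order.trans[OF abs_triangle_ineq] add_mono)
      (auto simp: abs_mult abs_minus_commute intro!: mult_left_mono)
  then have part3: "\<bar>X' / 2 * ((a1 n - L1) * K + (1 + L1) * (K - f' x))\<bar>
      \<le> \<bar>X'\<bar> / 2 * (\<bar>L1 - a1 n\<bar> * sup_norm f' + \<bar>1 + L1\<bar> * (13 / 4 * modulus2 f' (1 / sqrt (real n))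
                + 1 / sqrt (real n) * modulus1 f' (1 / sqrt (real n))))"
    unfolding abs_mult by (intro mult_mono) auto
  have "real n * (mod_bernstein_op a0 a1 n f x - f x)
            - x * (1 - x) / 2 * f'' x - (1 - 2 * x) / 2 * (1 + L1) * f' x
      = (real n * (B - f x) - x * (1 - x) / 2 * f'' x)
        + X' / 2 * ((a1 n - L1) * K + (1 + L1) * (K - f' x))"
    using mod_bernstein_op_eq[of a0 n a1 m f x, OF a[OF n] m, folded B_def K_def] unfolding X'
    by (simp add: field_simps)
  then show ?thesis
    unfolding D_def[symmetric]
    by (simp only: order.trans[OF abs_triangle_ineq add_mono[OF part1 part3]])
qed

end
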